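(* Let $\mathscr{G} = (\mathscr{V}, \mathscr{E})$ be a finite connected $D$-regular simple graph with $N$ vertices and $D \geq 1$, let $p \in [0,1]$, and let $S$ be the number of vertices in the bond percolation cluster (with parameter $p$) of a uniformly random vertex $x$ of $\mathscr{G}$. Let $q = 1 - p$. Then $$E (S) \leq N - (N - 1) q^D$$ and $$E (S^2) \leq N^2 - (N - 1)(2N - 1) q^D + (N - 1)(N - 2) q^{2D - 1}.$$
   Context: Bond percolation with parameter $p$ on $\mathscr{G}$: each edge is independently open with probability $p$ and closed with probability $1-p$. The vertex $x$ is chosen uniformly at random from $\mathscr{V}$, independently of the states of the edges. The cluster of $x$ is $\mathscr{C}_x = \{y \in \mathscr{V} : \text{there is a path of open edges connecting } x \text{ and } y\}$ (so $x \in \mathscr{C}_x$ always), and $S = \mathrm{card}(\mathscr{C}_x)$. *)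

theory Defs
  imports "HOL-Probability.Probability"
begin

text \<open>
  A simple graph is given by its vertex set and its set of edges, where an edge is
  the set of its two distinct end points.
\<close>

locale finite_simple_graph =
  fixes V :: "'a set" and E :: "'a set set"
  assumes finite_V: "finite V"
    and edges: "\<And>e. e \<in> E \<Longrightarrow> e \<subseteq> V \<and> card e = 2"

definition degree :: "'a set set \<Rightarrow> 'a \<Rightarrow> nat" where
  "degree E v = card {e \<in> E. v \<in> e}"

definition regular_graph :: "'a set \<Rightarrow> 'a set set \<Rightarrow> nat \<Rightarrow> bool" where
  "regular_graph V E D \<longleftrightarrow> (\<forall>v\<in>V. degree E v = D)"

text \<open>
  A path is the list of the vertices it visits; the one-vertex list is the path of length 0.
\<close>

definition path_between :: "'a set set \<Rightarrow> 'a \<Rightarrow> 'a list \<Rightarrow> 'a \<Rightarrow> bool" where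
  "path_between E x vs y \<longleftrightarrow>
     vs \<noteq> [] \<and> distinct vs \<and> successively (\<lambda>u v. {u, v} \<in> E) vs \<and> hd vs = x \<and> last vs = y"

text \<open>The empty graph does not count as connected.\<close>

definition connected_graph :: "'a set \<Rightarrow> 'a set set \<Rightarrow> bool" where
  "connected_graph V E \<longleftrightarrow> V \<noteq> {} \<and> (\<forall>x\<in>V. \<forall>y\<in>V. \<exists>vs. path_between E x vs y)"

text \<open>
  In a configuration \<open>\<omega>\<close> the edge \<open>e\<close> is open iff \<open>\<omega> e\<close> holds. Under \<open>Pi_pmf\<close> the states
  of the edges in \<open>E\<close> are independent; outside \<open>E\<close>, \<open>\<omega>\<close> is constantly \<open>False\<close>.
\<close>

definition bond_percolation :: "'a set set \<Rightarrow> real \<Rightarrow> ('a set \<Rightarrow> bool) pmf" where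
  "bond_percolation E p = Pi_pmf E False (\<lambda>_. bernoulli_pmf p)"

definition cluster :: "'a set \<Rightarrow> 'a set set \<Rightarrow> ('a set \<Rightarrow> bool) \<Rightarrow> 'a \<Rightarrow> 'a set" where
  "cluster V E \<omega> x = {y \<in> V. \<exists>vs. path_between {e \<in> E. \<omega> e} x vs y}"

text \<open>
  The joint law of the uniform vertex and the configuration; \<open>pair_pmf\<close> makes them independent.
\<close>

definition rooted_percolation ::
    "'a set \<Rightarrow> 'a set set \<Rightarrow> real \<Rightarrow> ('a \<times> ('a set \<Rightarrow> bool)) pmf" where
  "rooted_percolation V E p = pair_pmf (pmf_of_set V) (bond_percolation E p)"

definition cluster_size :: "'a set \<Rightarrow> 'a set set \<Rightarrow> 'a \<times> ('a set \<Rightarrow> bool) \<Rightarrow> real" where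
  "cluster_size V E = (\<lambda>(x, \<omega>). real (card (cluster V E \<omega> x)))"

end

theory Submission
  imports Defs
begin

text \<open>
  A vertex all of whose edges are closed is its own cluster, and it belongs to no other cluster.
  So in a configuration with \<open>k\<close> isolated vertices, \<open>k\<close> clusters have size \<open>1\<close> and the clusters of
  the other \<open>N - k\<close> vertices have size at most \<open>N - k\<close>. This bounds the sum of the squared cluster
  sizes by \<open>k + (N - k)\<^sup>3\<close>, which a factorisation compares with a quadratic polynomial in \<open>k\<close>.
  The first moment of \<open>k\<close> is \<open>N q\<^sup>D\<close>, and its second factorial moment is at most
  \<open>N (N - 1) q\<^bsup>2 D - 1\<^esup>\<close>, since two vertices share at most one edge.
\<close>

definition isolated :: "'a set \<Rightarrow> 'a set set \<Rightarrow> ('a set \<Rightarrow> bool) \<Rightarrow> 'a set" where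
  "isolated V E \<omega> = {x \<in> V. \<forall>e\<in>E. x \<in> e \<longrightarrow> \<not> \<omega> e}"

lemma isolated_subset: "isolated V E \<omega> \<subseteq> V"
  by (auto simp: isolated_def)

section \<open>End edges of paths, and clusters of isolated vertices\<close>

lemma successively_Cons_hd:
  "successively R (x # ys) \<Longrightarrow> ys \<noteq> [] \<Longrightarrow> R x (hd ys)"
  by (cases ys) auto

lemma successively_append_last:
  "successively R (ys @ [y]) \<Longrightarrow> ys \<noteq> [] \<Longrightarrow> R (last ys) y"
  by (simp add: successively_append_iff)

lemma path_between_first_edge:
  assumes "path_between E x vs y" "x \<noteq> y"
  shows "\<exists>e\<in>E. x \<in> e"
proof -
  from assms obtain ys where vs: "vs = x # ys" "ys \<noteq> []"
    unfolding path_between_def by (cases vs) (auto split: if_splits)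
  with assms have "{x, hd ys} \<in> E"
    unfolding path_between_def by (auto dest!: successively_Cons_hd)
  then show ?thesis by blast
qed

text \<open>Having both ends available avoids reversing paths: the first edge is used when the root
  is isolated, the last edge when the other endpoint is. Both are applied to the graph of open
  edges.\<close>

lemma path_between_last_edge:
  assumes "path_between E x vs y" "x \<noteq> y"
  shows "\<exists>e\<in>E. y \<in> e"
proof -
  from assms(1) obtain ys where vs: "vs = ys @ [y]"
    unfolding path_between_def by (cases vs rule: rev_cases) auto
  with assms have "ys \<noteq> []"
    unfolding path_between_def by auto
  with assms vs have "{last ys, y} \<in> E"
    unfolding path_between_def by (auto dest!: successively_append_last)
  then show ?thesis by blast
qed

lemma cluster_isolated:
  assumes "x \<in> isolated V E \<omega>"
  shows "cluster V E \<omega> x \<subseteq> {x}"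
  using assms unfolding cluster_def isolated_def
  by (auto dest: path_between_first_edge)

lemma cluster_not_isolated:
  assumes "x \<in> V - isolated V E \<omega>"
  shows "cluster V E \<omega> x \<subseteq> V - isolated V E \<omega>"
proof
  fix y assume "y \<in> cluster V E \<omega> x"
  then obtain vs where "y \<in> V" and vs: "path_between {e \<in> E. \<omega> e} x vs y"
    by (auto simp: cluster_def)
  have "y \<notin> isolated V E \<omega>"
    \<comment> \<open>If \<open>y\<close> differs from \<open>x\<close>, the last edge of the path
      is an open edge at \<open>y\<close>; if \<open>y = x\<close>, the assumption on
      \<open>x\<close> applies.\<close>
    using path_between_last_edge[OF vs] assms by (cases "x = y") (auto simp: isolated_def)
  with \<open>y \<in> V\<close> show "y \<in> V - isolated V E \<omega>" by simp
qed

text \<open>Each isolated vertex contributes at most 1. Each of the other n - k vertices contributes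
  at most (n - k)^m, which explains the exponent \<open>Suc m\<close>. The exponent is kept general
  so that both moments can use the bound.\<close>

lemma sum_cluster_size_power_le:
  assumes "finite V"
  shows "(\<Sum>x\<in>V. (cluster_size V E (x, \<omega>)) ^ m)
    \<le> real (card (isolated V E \<omega>)) + (real (card V) - real (card (isolated V E \<omega>))) ^ Suc m"
proof -
  let ?I = "isolated V E \<omega>"
  let ?S = "\<lambda>x. cluster_size V E (x, \<omega>)"
  have I: "?I \<subseteq> V" "finite ?I" "finite (V - ?I)"
    using assms isolated_subset[of V E \<omega>] by (auto dest: finite_subset)
  have card: "real (card (V - ?I)) = real (card V) - real (card ?I)"
    using I assms by (simp add: card_Diff_subset card_mono of_nat_diff)
  have "(\<Sum>x\<in>?I. ?S x ^ m) \<le> (\<Sum>x\<in>?I. 1)"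
  proof (rule sum_mono)
    fix x assume "x \<in> ?I"
    from card_mono[OF _ cluster_isolated[OF this]] have "?S x \<le> 1"
      by (simp add: cluster_size_def)
    then show "?S x ^ m \<le> 1"
      by (intro power_le_one) (auto simp: cluster_size_def)
  qed
  moreover have "(\<Sum>x\<in>V - ?I. ?S x ^ m) \<le> (\<Sum>x\<in>V - ?I. real (card (V - ?I)) ^ m)"
  proof (rule sum_mono)
    fix x assume "x \<in> V - ?I"
    from card_mono[OF I(3) cluster_not_isolated[OF this]]
    show "?S x ^ m \<le> real (card (V - ?I)) ^ m"
      by (intro power_mono) (auto simp: cluster_size_def)
  qed
  moreover have "(\<Sum>x\<in>V. ?S x ^ m) = (\<Sum>x\<in>V - ?I. ?S x ^ m) + (\<Sum>x\<in>?I. ?S x ^ m)"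
    using assms I(1) by (simp add: sum.subset_diff)
  ultimately show ?thesis by (simp add: card)
qed

section \<open>Polynomial inequalities in the number of isolated vertices\<close>

lemma linear_bound:
  fixes n k :: real
  assumes "0 \<le> k" "k \<le> n"
  shows "k + (n - k)\<^sup>2 \<le> n\<^sup>2 - (n - 1) * k"
proof -
  have "n\<^sup>2 - (n - 1) * k - (k + (n - k)\<^sup>2) = k * (n - k)"
    by (simp add: algebra_simps power2_eq_square)
  moreover have "0 \<le> k * (n - k)" using assms by simp
  ultimately show ?thesis by linarith
qed

text \<open>The gap between the two sides factors as k (n - k) (n + 2 - k), so the bound is sharp at
  k = 0 and k = n. The quadratic term is written with k (k - 1) because the expectation of that
  product counts pairs.\<close>

lemma quadratic_bound:
  fixes n k :: real
  assumes "0 \<le> k" "k \<le> n"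
  shows "k + (n - k) ^ 3 \<le> n ^ 3 - (n - 1) * (2 * n - 1) * k + (n - 2) * (k * (k - 1))"
proof -
  have "n ^ 3 - (n - 1) * (2 * n - 1) * k + (n - 2) * (k * (k - 1)) - (k + (n - k) ^ 3)
    = k * (n - k) * (n + 2 - k)"
    by (simp add: algebra_simps power3_eq_cube)
  moreover have "0 \<le> k * (n - k) * (n + 2 - k)" using assms by simp
  ultimately show ?thesis by linarith
qed

section \<open>Expectations under percolation, and prescribed closed edges\<close>

lemma finite_set_bond_percolation:
  assumes "finite E"
  shows "finite (set_pmf (bond_percolation E p))"
  unfolding bond_percolation_def
  by (rule finite_subset[OF set_Pi_pmf_subset']) (auto simp: assms)

lemma expectation_rooted_percolation:
  fixes f :: "'a \<times> ('a set \<Rightarrow> bool) \<Rightarrow> real"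
  assumes "finite V" "V \<noteq> {}" "finite E"
  shows "measure_pmf.expectation (rooted_percolation V E p) f
    = measure_pmf.expectation (bond_percolation E p) (\<lambda>\<omega>. \<Sum>x\<in>V. f (x, \<omega>)) / real (card V)"
proof -
  have "rooted_percolation V E p
      = pmf_of_set V \<bind> (\<lambda>x. map_pmf (Pair x) (bond_percolation E p))"
    by (simp add: rooted_percolation_def pair_pmf_def map_pmf_def)
  then show ?thesis
    using assms finite_set_bond_percolation[OF assms(3)]
    by (simp add: pmf_expectation_bind_pmf_of_set Bochner_Integration.integral_sum
        integrable_measure_pmf_finite sum_divide_distrib divide_inverse sum_distrib_left mult.commute)
qed

lemma prob_all_closed:
  assumes "finite E" "A \<subseteq> E" "0 \<le> p" "p \<le> 1"
  shows "measure_pmf.prob (bond_percolation E p) {\<omega>. \<forall>e\<in>A. \<not> \<omega> e} = (1 - p) ^ card A"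
proof -
  \<comment> \<open>As a box with one factor per edge, the event has a probability that splits into
    a product; edges outside \<open>A\<close> contribute 1.\<close>
  have "{\<omega>. \<forall>e\<in>A. \<not> \<omega> e} = Pi E (\<lambda>e. if e \<in> A then {False} else UNIV)"
    using assms(2) by (auto simp: Pi_def split: if_splits)
  then have "measure_pmf.prob (bond_percolation E p) {\<omega>. \<forall>e\<in>A. \<not> \<omega> e}
      = (\<Prod>e\<in>E. measure_pmf.prob (bernoulli_pmf p) (if e \<in> A then {False} else UNIV))"
    using assms(1) by (simp add: bond_percolation_def measure_Pi_pmf_Pi)
  also have "\<dots> = (\<Prod>e\<in>E. if e \<in> A then 1 - p else 1)"
    using assms(3,4) by (intro prod.cong) (auto simp: measure_pmf_single)
  also have "\<dots> = (1 - p) ^ card A"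
    using assms(1,2) by (simp add: prod.If_cases Int_absorb1)
  finally show ?thesis .
qed

section \<open>First and second factorial moments of the number of isolated vertices\<close>

context finite_simple_graph
begin

lemma finite_E: "finite E"
  by (rule finite_subset[of _ "Pow V"]) (use edges finite_V in auto)

lemma card_common_edges:
  assumes "x \<noteq> y"
  shows "card {e \<in> E. x \<in> e \<and> y \<in> e} \<le> 1"
proof -
  have "{e \<in> E. x \<in> e \<and> y \<in> e} \<subseteq> {{x, y}}"
    using edges assms by (auto simp: card_2_iff)
  from card_mono[OF _ this] show ?thesis by simp
qed

text \<open>Inclusion-exclusion: the two stars have D edges each, and only the edge {x, y} can be
  counted twice.\<close>

lemma card_edges_meeting_pair:
  assumes "regular_graph V E D" "x \<in> V" "y \<in> V" "x \<noteq> y"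
  shows "2 * D - 1 \<le> card {e \<in> E. x \<in> e \<or> y \<in> e}"
proof -
  let ?A = "\<lambda>z. {e \<in> E. z \<in> e}"
  have "card (?A x) + card (?A y) = card (?A x \<union> ?A y) + card (?A x \<inter> ?A y)"
    by (rule card_Un_Int) (simp_all add: finite_E)
  moreover have "?A x \<union> ?A y = {e \<in> E. x \<in> e \<or> y \<in> e}" by auto
  moreover have "?A x \<inter> ?A y = {e \<in> E. x \<in> e \<and> y \<in> e}" by auto
  ultimately show ?thesis
    using assms card_common_edges[OF assms(4)] by (simp add: regular_graph_def degree_def)
qed

lemma integrable_bond_percolation [simp]:
  fixes f :: "('a set \<Rightarrow> bool) \<Rightarrow> real"
  shows "integrable (measure_pmf (bond_percolation E p)) f"
  by (rule integrable_measure_pmf_finite[OF finite_set_bond_percolation[OF finite_E]])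

lemma card_isolated_eq_sum:
  "real (card (isolated V E \<omega>)) = (\<Sum>x\<in>V. indicator {\<omega>. x \<in> isolated V E \<omega>} \<omega>)"
  using finite_V isolated_subset[of V E \<omega>]
  by (simp add: indicator_def sum.If_cases Int_absorb1)

lemma expectation_card_isolated:
  assumes "regular_graph V E D" "0 \<le> p" "p \<le> 1"
  shows "measure_pmf.expectation (bond_percolation E p) (\<lambda>\<omega>. real (card (isolated V E \<omega>)))
    = real (card V) * (1 - p) ^ D"
proof -
  have "measure_pmf.prob (bond_percolation E p) {\<omega>. x \<in> isolated V E \<omega>} = (1 - p) ^ D"
    if "x \<in> V" for x
  proof -
    have "{\<omega>. x \<in> isolated V E \<omega>} = {\<omega>. \<forall>e\<in>{e \<in> E. x \<in> e}. \<not> \<omega> e}"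
      using that by (auto simp: isolated_def)
    then show ?thesis
      using prob_all_closed[OF finite_E, of "{e \<in> E. x \<in> e}" p] assms that
      by (simp add: regular_graph_def degree_def)
  qed
  then show ?thesis
    by (simp add: card_isolated_eq_sum Bochner_Integration.integral_sum)
qed

text \<open>The integrand counts ordered pairs of distinct isolated vertices. For each pair all
  edges meeting it must be closed. Nonadjacent pairs meet 2 D edges and adjacent ones 2 D - 1, hence
  an inequality.\<close>

lemma expectation_card_isolated_pairs:
  assumes "regular_graph V E D" "0 \<le> p" "p \<le> 1"
  shows "measure_pmf.expectation (bond_percolation E p)
      (\<lambda>\<omega>. real (card (isolated V E \<omega>)) * (real (card (isolated V E \<omega>)) - 1))
    \<le> real (card V) * (real (card V) - 1) * (1 - p) ^ (2 * D - 1)"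
proof -
  let ?I = "isolated V E" and ?q = "(1 - p) ^ (2 * D - 1)"
  let ?J = "\<lambda>x y. {\<omega>. x \<in> isolated V E \<omega> \<and> y \<in> isolated V E \<omega>}"
  have pairs: "real (card (?I \<omega>)) * (real (card (?I \<omega>)) - 1)
      = (\<Sum>x\<in>V. \<Sum>y\<in>V - {x}. indicator (?J x y) \<omega>)" for \<omega>
  proof -
    \<comment> \<open>If \<open>x\<close> is isolated, leaving it out of the count gives the -1;
      otherwise both sides vanish.\<close>
    have "(\<Sum>y\<in>V - {x}. indicator (?J x y) \<omega>)
        = indicator {\<omega>. x \<in> ?I \<omega>} \<omega> * (real (card (?I \<omega>)) - 1)" if "x \<in> V" for x
    proof (cases "x \<in> ?I \<omega>")
      case True
      then have "(\<Sum>y\<in>V - {x}. indicator (?J x y) \<omega>)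
          = (\<Sum>y\<in>V - {x}. indicator {\<omega>. y \<in> ?I \<omega>} \<omega> :: real)"
        by (simp add: indicator_def)
      also have "\<dots> = real (card (?I \<omega>)) - 1"
        using True that finite_V unfolding card_isolated_eq_sum by (subst sum_diff1) simp_all
      finally show ?thesis using True by simp
    qed simp
    then show ?thesis
      by (simp add: sum_distrib_right[symmetric] card_isolated_eq_sum[symmetric])
  qed
  have prob: "measure_pmf.prob (bond_percolation E p) (?J x y) \<le> ?q"
    if "x \<in> V" "y \<in> V - {x}" for x y
  proof -
    have "?J x y = {\<omega>. \<forall>e\<in>{e \<in> E. x \<in> e \<or> y \<in> e}. \<not> \<omega> e}"
      using that by (auto simp: isolated_def)
    then have "measure_pmf.prob (bond_percolation E p) (?J x y)
        = (1 - p) ^ card {e \<in> E. x \<in> e \<or> y \<in> e}"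
      using prob_all_closed[OF finite_E, of "{e \<in> E. x \<in> e \<or> y \<in> e}" p] assms by simp
    \<comment> \<open>Since 1 - p lies in [0, 1], more edges to close means a smaller power.\<close>
    also have "\<dots> \<le> ?q"
      using that assms by (intro power_decreasing card_edges_meeting_pair) auto
    finally show ?thesis .
  qed
  have "measure_pmf.expectation (bond_percolation E p)
      (\<lambda>\<omega>. real (card (?I \<omega>)) * (real (card (?I \<omega>)) - 1))
    = (\<Sum>x\<in>V. \<Sum>y\<in>V - {x}. measure_pmf.prob (bond_percolation E p) (?J x y))"
    by (simp add: pairs Bochner_Integration.integral_sum)
  also have "\<dots> \<le> (\<Sum>x\<in>V. \<Sum>y\<in>V - {x}. ?q)"
    by (intro sum_mono prob)
  also have "\<dots> = real (card V) * (real (card V) - 1) * ?q"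
    using finite_V by (cases "V = {}")
      (simp_all add: card_Diff_singleton of_nat_diff Suc_leI card_gt_0_iff)
  finally show ?thesis .
qed

section \<open>Moments of the cluster size\<close>

lemma expectation_cluster_size_power_le:
  assumes "V \<noteq> {}"
  shows "measure_pmf.expectation (rooted_percolation V E p) (\<lambda>\<xi>. cluster_size V E \<xi> ^ m)
    \<le> measure_pmf.expectation (bond_percolation E p)
        (\<lambda>\<omega>. real (card (isolated V E \<omega>))
          + (real (card V) - real (card (isolated V E \<omega>))) ^ Suc m) / real (card V)"
  unfolding expectation_rooted_percolation[OF finite_V assms finite_E]
  by (intro divide_right_mono integral_mono sum_cluster_size_power_le finite_V
      integrable_bond_percolation) simp

text \<open>Positive degree yields an edge, whose two endpoints lie in \<open>V\<close>. The bound
  supplies the sign of n - 2 in the second moment estimate.\<close>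

lemma card_V_ge_2:
  assumes "regular_graph V E D" "V \<noteq> {}" "D \<ge> 1"
  shows "2 \<le> card V"
proof -
  from assms(2) obtain x where "x \<in> V" by blast
  with assms have "0 < card {e \<in> E. x \<in> e}"
    by (simp add: regular_graph_def degree_def)
  then obtain e where "e \<in> E" by (auto simp: card_gt_0_iff)
  with edges card_mono[OF finite_V] show ?thesis by metis
qed

lemma expectation_cluster_size_le:
  assumes "regular_graph V E D" "V \<noteq> {}" "0 \<le> p" "p \<le> 1"
  shows "measure_pmf.expectation (rooted_percolation V E p) (cluster_size V E)
    \<le> real (card V) - (real (card V) - 1) * (1 - p) ^ D"
proof -
  let ?n = "real (card V)" and ?k = "\<lambda>\<omega>. real (card (isolated V E \<omega>))"
  let ?E = "measure_pmf.expectation (bond_percolation E p)"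
  have n: "?n > 0" using assms finite_V by (simp add: card_gt_0_iff)
  have "?E (\<lambda>\<omega>. ?k \<omega> + (?n - ?k \<omega>)\<^sup>2) \<le> ?E (\<lambda>\<omega>. ?n\<^sup>2 - (?n - 1) * ?k \<omega>)"
    by (intro integral_mono linear_bound) (auto intro!: card_mono finite_V isolated_subset)
  also have "\<dots> = ?n\<^sup>2 - (?n - 1) * (?n * (1 - p) ^ D)"
    using expectation_card_isolated[OF assms(1,3,4)] by simp
  \<comment> \<open>The factor n is split off to cancel the 1/n of the uniform root.\<close>
  also have "\<dots> = (?n - (?n - 1) * (1 - p) ^ D) * ?n"
    by (simp add: algebra_simps power2_eq_square)
  finally have "?E (\<lambda>\<omega>. ?k \<omega> + (?n - ?k \<omega>)\<^sup>2) / ?n \<le> ?n - (?n - 1) * (1 - p) ^ D"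
    using n by (simp add: pos_divide_le_eq)
  with expectation_cluster_size_power_le[OF assms(2), of p 1] show ?thesis
    by (simp add: numeral_2_eq_2)
qed

lemma expectation_cluster_size_square_le:
  assumes "regular_graph V E D" "V \<noteq> {}" "D \<ge> 1" "0 \<le> p" "p \<le> 1"
  shows "measure_pmf.expectation (rooted_percolation V E p) (\<lambda>\<xi>. (cluster_size V E \<xi>)\<^sup>2)
    \<le> (real (card V))\<^sup>2 - (real (card V) - 1) * (2 * real (card V) - 1) * (1 - p) ^ D
      + (real (card V) - 1) * (real (card V) - 2) * (1 - p) ^ (2 * D - 1)"
    (is "_ \<le> ?rhs")
proof -
  let ?n = "real (card V)" and ?k = "\<lambda>\<omega>. real (card (isolated V E \<omega>))"
  let ?E = "measure_pmf.expectation (bond_percolation E p)"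
  have n: "?n \<ge> 2" using card_V_ge_2[OF assms(1-3)] by simp
  have "?E (\<lambda>\<omega>. ?k \<omega> + (?n - ?k \<omega>) ^ 3)
      \<le> ?E (\<lambda>\<omega>. ?n ^ 3 - (?n - 1) * (2 * ?n - 1) * ?k \<omega> + (?n - 2) * (?k \<omega> * (?k \<omega> - 1)))"
    by (intro integral_mono quadratic_bound) (auto intro!: card_mono finite_V isolated_subset)
  also have "\<dots> = ?n ^ 3 - (?n - 1) * (2 * ?n - 1) * ?E ?k
      + (?n - 2) * ?E (\<lambda>\<omega>. ?k \<omega> * (?k \<omega> - 1))"
    by (simp add: Bochner_Integration.integral_add Bochner_Integration.integral_diff)
  \<comment> \<open>The first moment is substituted exactly, so its negative coefficient does no
    harm; the pair moment is only bounded above, which is where n - 2 \<ge> 0 enters.\<close>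
  also have "\<dots> \<le> ?n ^ 3 - (?n - 1) * (2 * ?n - 1) * (?n * (1 - p) ^ D)
      + (?n - 2) * (?n * (?n - 1) * (1 - p) ^ (2 * D - 1))"
    unfolding expectation_card_isolated[OF assms(1,4,5)]
    using n by (intro add_left_mono mult_left_mono
        expectation_card_isolated_pairs[OF assms(1,4,5)]) simp
  also have "\<dots> = ?rhs * ?n"
    by (simp add: algebra_simps power2_eq_square power3_eq_cube)
  finally have "?E (\<lambda>\<omega>. ?k \<omega> + (?n - ?k \<omega>) ^ 3) / ?n \<le> ?rhs"
    using n by (simp add: pos_divide_le_eq)
  with expectation_cluster_size_power_le[OF assms(2), of p 2] show ?thesis
    by (simp add: numeral_3_eq_3 numeral_2_eq_2)
qed

end

theorem theorem2:
  fixes V :: "'a set" and E :: "'a set set" and N D :: nat and p q :: real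
  assumes "finite_simple_graph V E"
    and "connected_graph V E"
    and "regular_graph V E D"
    and "card V = N"
    and "D \<ge> 1"
    and "0 \<le> p" and "p \<le> 1"
    and "q = 1 - p"
  shows "measure_pmf.expectation (rooted_percolation V E p) (cluster_size V E)
           \<le> real N - (real N - 1) * q ^ D
       \<and> measure_pmf.expectation (rooted_percolation V E p) (\<lambda>\<xi>. (cluster_size V E \<xi>)\<^sup>2)
           \<le> (real N)\<^sup>2 - (real N - 1) * (2 * real N - 1) * q ^ D
             + (real N - 1) * (real N - 2) * q ^ (2 * D - 1)"
proof -
  interpret finite_simple_graph V E by fact
  have "V \<noteq> {}" using assms(2) by (simp add: connected_graph_def)
  with assms show ?thesis
    using expectation_cluster_size_le[of D p] expectation_cluster_size_square_le[of D p] by simp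
qed

end
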